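(* Let $A\in\mathbb{X}^{n\times n}$ be a matrix with spectral radius $\lambda>\mathsf{0}$. Consider the problem of minimizing $x^{-}Ax$ over all regular vectors $x\in\mathbb{X}^{n}$. Then the minimum is equal to $\lambda$, and all regular solutions of the problem are given by $x=(\lambda^{-1}A)^{\ast}u$, $u\in\mathbb{X}^{n}$; that is, a regular vector $x\in\mathbb{X}^{n}$ attains the minimum if and only if $x=(\lambda^{-1}A)^{\ast}u$ for some $u\in\mathbb{X}^{n}$.
   Context: $\langle\mathbb{X},\mathsf{0},\mathsf{1},\oplus,\otimes\rangle$ is an idempotent semifield: $\oplus$ and $\otimes$ are associative and commutative, with neutral elements $\mathsf{0}$ (zero) and $\mathsf{1}$ (identity) respectively; $\otimes$ distributes over $\oplus$ and $\mathsf{0}$ is absorbing for $\otimes$; addition is idempotent ($x\oplus x=x$); every $x\neq\mathsf{0}$ has a multiplicative inverse $x^{-1}$. The sign $\otimes$ is omitted. Integer powers are in the sense of $\otimes$, and the semifield is assumed radicable (powers with rational exponents exist), with $\mathsf{0}^{p}=\mathsf{0}$ for $p>0$. The order is $x\leq y$ iff $x\oplus y=y$, and it is assumed to be total; minimization is with respect to this order. Matrices and vectors over $\mathbb{X}$ are added and multiplied by the usual rules with $\oplus,\otimes$ in place of $+,\times$; $\mathbb{X}^{n}$ is the set of column vectors of order $n$. A vector is regular if none of its entries is $\mathsf{0}$. For a nonzero column vector $x=(x_i)$, the multiplicative conjugate transpose $x^{-}=(x_i^{-})$ is the row vector with $x_i^{-}=x_i^{-1}$ if $x_i\neq\mathsf{0}$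 and $x_i^{-}=\mathsf{0}$ otherwise. $I$ is the identity matrix ($\mathsf{1}$ on the diagonal, $\mathsf{0}$ elsewhere), $A^{0}=I$, $A^{p}=A^{p-1}A$. For $A=(a_{ij})\in\mathbb{X}^{n\times n}$: $\mathrm{tr}A=a_{11}\oplus\cdots\oplus a_{nn}$ and $A^{\ast}=I\oplus A\oplus\cdots\oplus A^{n-1}$. A scalar $\lambda\in\mathbb{X}$ is an eigenvalue of $A$ if $Ax=\lambda x$ for some nonzero $x\in\mathbb{X}^{n}$; the spectral radius of $A$ is its maximal eigenvalue, which is given by $\lambda=\bigoplus_{m=1}^{n}\left(\mathrm{tr}(A^{m})\right)^{1/m}$. *)

theory Defs
  imports "HOL-Analysis.Analysis"
begin

text \<open>
  The semifield operations are written \<open>+\<close>, \<open>*\<close>, \<open>0\<close>, \<open>1\<close>, so that the matrix operations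
  \<open>**\<close>, \<open>*v\<close>, \<open>v*\<close>, \<open>mat\<close> (defined in the library over any \<open>semiring_1\<close>) are the
  semifield ones. Nothing is assumed about \<open>inverse 0\<close>. Since \<open>\<le>\<close> is a total order,
  the roots provided by \<open>radicable\<close> are unique.
\<close>

class radicable_idempotent_semifield = comm_semiring_1 + inverse + linorder +
  assumes add_idem: "x + x = x"
    and le_iff_add_eq: "x \<le> y \<longleftrightarrow> x + y = y"
    and inverse_mult_cancel: "x \<noteq> 0 \<Longrightarrow> inverse x * x = 1"
    and divide_eq_mult_inverse: "x / y = x * inverse y"
    and radicable: "0 < n \<Longrightarrow> \<exists>y. y ^ n = x"

definition regular :: "'a::zero ^ 'n \<Rightarrow> bool" where
  "regular x \<longleftrightarrow> (\<forall>i. x $ i \<noteq> 0)"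

definition conj_transpose :: "'a::radicable_idempotent_semifield ^ 'n \<Rightarrow> 'a ^ 'n" where
  "conj_transpose x = (\<chi> i. if x $ i = 0 then 0 else inverse (x $ i))"

text \<open>A row vector is represented by a vector that is multiplied from the left, with \<open>v*\<close>.\<close>

definition quad_form :: "'a::radicable_idempotent_semifield ^ 'n ^ 'n \<Rightarrow> 'a ^ 'n \<Rightarrow> 'a" where
  "quad_form A x = scalar_product (conj_transpose x v* A) x"

definition scale_matrix :: "'a::times \<Rightarrow> 'a ^ 'n ^ 'm \<Rightarrow> 'a ^ 'n ^ 'm" where
  "scale_matrix c A = map_matrix (\<lambda>a. c * a) A"

text \<open>
  The library's \<open>*\<close>, \<open>1\<close> and \<open>^\<close> on matrices act entrywise; hence the separate matrix power.
\<close>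

primrec matrix_power :: "'a::semiring_1 ^ 'n ^ 'n \<Rightarrow> nat \<Rightarrow> 'a ^ 'n ^ 'n" where
  "matrix_power A 0 = mat 1"
| "matrix_power A (Suc p) = matrix_power A p ** A"

definition kleene_star :: "'a::semiring_1 ^ 'n ^ 'n \<Rightarrow> 'a ^ 'n ^ 'n" where
  "kleene_star A = (\<Sum>p<CARD('n). matrix_power A p)"

definition is_eigenvalue :: "'a::semiring_1 ^ 'n ^ 'n \<Rightarrow> 'a \<Rightarrow> bool" where
  "is_eigenvalue A c \<longleftrightarrow> (\<exists>x. x \<noteq> 0 \<and> A *v x = c *s x)"

definition spectral_radius :: "'a::radicable_idempotent_semifield ^ 'n ^ 'n \<Rightarrow> 'a" where
  "spectral_radius A = (GREATEST c. is_eigenvalue A c)"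

end

theory Submission
  imports Defs
begin

text \<open>
  Write \<open>B = \<lambda>\<inverse>A\<close>. For a regular \<open>x\<close>, the bound \<open>x\<^sup>-Ax \<le> c\<close> unfolds to the system of inequalities
  \<open>Ax \<le> cx\<close>, so the sublevel set at \<open>\<lambda>\<close> is the set of regular solutions of \<open>Bx \<le> x\<close>. If
  \<open>BB\<^sup>* \<le> B\<^sup>*\<close>, these are exactly the regular vectors \<open>B\<^sup>*u\<close>: such a vector satisfies the
  inequality, and conversely \<open>Bx \<le> x\<close> iterates to \<open>B\<^sup>px \<le> x\<close> for all \<open>p\<close>, whence \<open>x = B\<^sup>*x\<close>. The
  vector \<open>B\<^sup>*(1,\<dots>,1)\<close> is one of them. On the other hand any eigenvalue \<open>c\<close> of \<open>A\<close>, with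
  eigenvector \<open>v\<close>, is a lower bound for \<open>x\<^sup>-Ax\<close>: scale \<open>x\<close> until it touches \<open>v\<close> from above, and compare
  \<open>Av = cv\<close> with \<open>Ax \<le> (x\<^sup>-Ax)x\<close> at an index of contact. Thus the theorem holds for every
  positive eigenvalue \<open>\<lambda>\<close> for which \<open>(\<lambda>\<inverse>A)\<^sup>*\<close> absorbs \<open>\<lambda>\<inverse>A\<close>.

  It remains to see that the greatest eigenvalue is of this kind (or zero), and that it exists.
  Let \<open>\<mu>\<close> be the maximal \<open>m\<close>-th root of a diagonal entry of \<open>A\<^sup>m\<close>, over \<open>1 \<le> m \<le> n\<close>. The combinatorial
  core is the pigeonhole principle: a walk with \<open>n\<close> steps among \<open>n\<close> indices contains a cycle, so an entry of
  \<open>A\<^sup>n\<close> is at most a diagonal entry of some \<open>A\<^sup>m\<close> times the corresponding entry of \<open>A\<^sup>n\<^sup>-\<^sup>m\<close>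
  (lemma \<open>matrix_power_card_le_cycle\<close>). If \<open>\<mu> = 0\<close>, this makes \<open>A\<close> nilpotent, and \<open>0\<close> is its only
  eigenvalue. If \<open>\<mu> > 0\<close>, the normalized matrix \<open>B = \<mu>\<inverse>A\<close> has all its cycles bounded by \<open>1\<close>, which gives
  \<open>B\<^sup>n \<le> B\<^sup>*\<close> and hence \<open>BB\<^sup>* \<le> B\<^sup>*\<close>; and some cycle attains \<open>1\<close>, which makes the column of \<open>B\<^sup>*\<close> at
  a vertex of this cycle an eigenvector of \<open>A\<close> for \<open>\<mu>\<close>. No eigenvalue exceeds \<open>\<mu>\<close>, because
  \<open>B\<^sup>*(1,\<dots>,1)\<close> is regular with quadratic form at most \<open>\<mu>\<close>.
\<close>

section \<open>Order and cancellation in an idempotent semifield\<close>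

lemma zero_least: "0 \<le> (x::'a::radicable_idempotent_semifield)"
  by (simp add: le_iff_add_eq)

instance radicable_idempotent_semifield \<subseteq> ordered_comm_semiring
proof
  fix a b c :: 'a
  assume "a \<le> b"
  then have ab: "a + b = b" by (simp add: le_iff_add_eq)
  have "(c + a) + (c + b) = (c + c) + (a + b)" by (simp add: ac_simps)
  then show "c + a \<le> c + b" by (simp add: le_iff_add_eq add_idem ab)
  show "c * a \<le> c * b"
    by (simp add: le_iff_add_eq ab flip: distrib_left)
qed

instance radicable_idempotent_semifield \<subseteq> ordered_semiring_1
  by standard (use zero_least[of "1::'a"] in \<open>simp add: order_less_le\<close>)

lemma pos_iff_nonzero: "0 < (x::'a::radicable_idempotent_semifield) \<longleftrightarrow> x \<noteq> 0"
  using zero_least[of x] by (auto simp: order_less_le)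

lemma mult_le_mult:
  fixes a b c d :: "'a::radicable_idempotent_semifield"
  shows "a \<le> b \<Longrightarrow> c \<le> d \<Longrightarrow> a * c \<le> b * d"
  by (rule mult_mono) (auto simp: zero_least)

lemma inverse_mult_cancel_left:
  fixes c :: "'a::radicable_idempotent_semifield"
  assumes "c \<noteq> 0"
  shows "inverse c * (c * a) = a" "c * (inverse c * a) = a"
  using inverse_mult_cancel[OF assms] by (metis mult.assoc mult.commute mult_1_left)+

lemma mult_le_cancel_nonzero:
  fixes c :: "'a::radicable_idempotent_semifield"
  assumes "c \<noteq> 0"
  shows "c * a \<le> c * b \<longleftrightarrow> a \<le> b"
  by (metis assms inverse_mult_cancel_left(1) mult_le_mult order_refl)

lemma inverse_mult_le_iff:
  fixes c :: "'a::radicable_idempotent_semifield"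
  assumes "c \<noteq> 0"
  shows "inverse c * a \<le> b \<longleftrightarrow> a \<le> c * b"
  using mult_le_cancel_nonzero[OF assms, of "inverse c * a" b]
  by (simp add: inverse_mult_cancel_left[OF assms])

lemma mult_nonzero:
  fixes a b :: "'a::radicable_idempotent_semifield"
  shows "a \<noteq> 0 \<Longrightarrow> b \<noteq> 0 \<Longrightarrow> a * b \<noteq> 0"
  using inverse_mult_cancel_left(1)[of a b] by auto

lemma power_nonzero:
  fixes a :: "'a::radicable_idempotent_semifield"
  shows "a \<noteq> 0 \<Longrightarrow> a ^ k \<noteq> 0"
  by (induction k) (auto simp: mult_nonzero)

text \<open>
  With idempotent addition and a total order, a finite sum is the maximum of its terms.
\<close>

lemma sum_le_iff:
  fixes f :: "'b \<Rightarrow> 'a::radicable_idempotent_semifield"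
  assumes "finite S"
  shows "sum f S \<le> c \<longleftrightarrow> (\<forall>i\<in>S. f i \<le> c)"
proof
  show "\<forall>i\<in>S. f i \<le> c" if "sum f S \<le> c"
    using that member_le_sum[of _ S f] assms zero_least by (metis order_trans)
  show "sum f S \<le> c" if "\<forall>i\<in>S. f i \<le> c"
    using assms that
  proof (induction S rule: finite_induct)
    case (insert i S)
    then have "f i + sum f S \<le> c + c" by (intro add_mono) auto
    then show ?case using insert by (simp add: add_idem)
  qed (simp add: zero_least)
qed

lemma le_sum:
  fixes f :: "'b \<Rightarrow> 'a::radicable_idempotent_semifield"
  shows "finite S \<Longrightarrow> i \<in> S \<Longrightarrow> f i \<le> sum f S"
  using sum_le_iff[of S f "sum f S"] by auto

lemma sum_attained:
  fixes f :: "'b \<Rightarrow> 'a::radicable_idempotent_semifield"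
  assumes "finite S" "S \<noteq> {}"
  obtains i where "i \<in> S" "sum f S = f i"
proof -
  have "Max (f ` S) \<in> f ` S" using assms by (intro Max_in) auto
  then obtain i where "i \<in> S" "f i = Max (f ` S)" by auto
  moreover have "sum f S \<le> f i"
    using assms \<open>f i = _\<close> by (simp add: sum_le_iff)
  ultimately show thesis
    using that le_sum[of S i f] assms(1) by (metis order_antisym)
qed

section \<open>Matrix powers and walks\<close>

lemma matrix_power_add: "matrix_power A (p + q) = matrix_power A p ** matrix_power A q"
  by (induction q) (simp_all add: matrix_mul_assoc)

lemma matrix_power_Suc_left: "matrix_power A (Suc p) = A ** matrix_power A p"
  using matrix_power_add[of A 1 p] by simp

lemma matrix_power_scale:
  fixes A :: "'a::radicable_idempotent_semifield ^ 'n ^ 'n"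
  shows "matrix_power (scale_matrix c A) p $ i $ j = c ^ p * matrix_power A p $ i $ j"
proof (induction p arbitrary: j)
  case 0
  show ?case by (simp add: mat_def)
next
  case (Suc p)
  then show ?case
    by (simp add: matrix_matrix_mult_def scale_matrix_def sum_distrib_left mult_ac)
qed

lemma matrix_power_mult_entry_le:
  fixes A :: "'a::radicable_idempotent_semifield ^ 'n ^ 'n"
  shows "matrix_power A p $ i $ l * matrix_power A q $ l $ j \<le> matrix_power A (p + q) $ i $ j"
  unfolding matrix_power_add matrix_matrix_mult_def
  using le_sum[of UNIV l "\<lambda>l. matrix_power A p $ i $ l * matrix_power A q $ l $ j"] by simp

text \<open>
  An entry of \<open>A\<^sup>p\<close> is the maximal weight of a walk with \<open>p\<close> steps; the next two lemmas are the
  two halves of this.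
\<close>

lemma walk_weight_le_matrix_power:
  fixes A :: "'a::radicable_idempotent_semifield ^ 'n ^ 'n"
  shows "(\<Prod>k=a..<a+p. A $ w k $ w (Suc k)) \<le> matrix_power A p $ w a $ w (a + p)"
proof (induction p)
  case 0
  show ?case by (simp add: mat_def)
next
  case (Suc p)
  then have "(\<Prod>k=a..<a+p. A $ w k $ w (Suc k)) * A $ w (a + p) $ w (Suc (a + p))
      \<le> matrix_power A p $ w a $ w (a + p) * A $ w (a + p) $ w (Suc (a + p))"
    by (intro mult_le_mult) auto
  also have "\<dots> \<le> matrix_power A (Suc p) $ w a $ w (a + Suc p)"
    using matrix_power_mult_entry_le[of A p "w a" "w (a + p)" 1] by simp
  finally show ?case by simp
qed

lemma matrix_power_attained_by_walk:
  fixes A :: "'a::radicable_idempotent_semifield ^ 'n ^ 'n"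
  assumes "matrix_power A p $ i $ j \<noteq> 0"
  shows "\<exists>w. w 0 = i \<and> w p = j \<and> matrix_power A p $ i $ j = (\<Prod>k=0..<p. A $ w k $ w (Suc k))"
  using assms
proof (induction p arbitrary: j)
  case 0
  then show ?case by (intro exI[of _ "\<lambda>_. i"]) (auto simp: mat_def split: if_splits)
next
  case (Suc p)
  obtain l where l: "matrix_power A (Suc p) $ i $ j = matrix_power A p $ i $ l * A $ l $ j"
    using sum_attained[of UNIV "\<lambda>l. matrix_power A p $ i $ l * A $ l $ j"]
    by (auto simp: matrix_matrix_mult_def)
  with Suc.prems have "matrix_power A p $ i $ l \<noteq> 0" by auto
  from Suc.IH[OF this] obtain w where w: "w 0 = i" "w p = l"
    "matrix_power A p $ i $ l = (\<Prod>k=0..<p. A $ w k $ w (Suc k))" by blast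
  let ?w = "w(Suc p := j)"
  have "(\<Prod>k=0..<p. A $ ?w k $ ?w (Suc k)) = (\<Prod>k=0..<p. A $ w k $ w (Suc k))"
    by (intro prod.cong) auto
  then show ?case using l w by (intro exI[of _ ?w]) simp
qed

text \<open>
  A walk with as many steps as there are indices visits some index twice. The part between two such visits is a
  cycle; removing it leaves a shorter walk with the same ends.
\<close>

lemma matrix_power_card_le_cycle:
  fixes A :: "'a::radicable_idempotent_semifield ^ 'n ^ 'n"
  shows "\<exists>m\<in>{1..CARD('n)}. \<exists>l. matrix_power A CARD('n) $ i $ j
           \<le> matrix_power A m $ l $ l * matrix_power A (CARD('n) - m) $ i $ j"
proof (cases "matrix_power A CARD('n) $ i $ j = 0")
  case True
  then show ?thesis by (auto simp: zero_least intro!: bexI[of _ 1])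
next
  case False
  let ?n = "CARD('n)"
  obtain w where w: "w 0 = i" "w ?n = j"
    "matrix_power A ?n $ i $ j = (\<Prod>k=0..<?n. A $ w k $ w (Suc k))"
    using matrix_power_attained_by_walk[OF False] by blast
  have "\<not> inj_on w {0..?n}"
  proof
    assume "inj_on w {0..?n}"
    then have "card {0..?n} \<le> ?n"
      by (intro card_inj_on_le[of w]) auto
    then show False by simp
  qed
  then obtain a b where ab: "a < b" "b \<le> ?n" "w a = w b"
    unfolding inj_on_def by (metis atLeastAtMost_iff linorder_neqE_nat)
  let ?W = "\<lambda>s t. \<Prod>k=s..<t. A $ w k $ w (Suc k)"
  have "matrix_power A ?n $ i $ j = ?W 0 a * ?W a b * ?W b ?n"
    using ab by (simp add: w(3) prod.atLeastLessThan_concat)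
  also have "\<dots> \<le> matrix_power A a $ i $ w a * matrix_power A (b - a) $ w a $ w a
      * matrix_power A (?n - b) $ w a $ j"
    using walk_weight_le_matrix_power[of A w 0 a] walk_weight_le_matrix_power[of A w a "b - a"]
      walk_weight_le_matrix_power[of A w b "?n - b"] ab w(1,2)
    by (intro mult_le_mult) auto
  also have "\<dots> = matrix_power A (b - a) $ w a $ w a
      * (matrix_power A a $ i $ w a * matrix_power A (?n - b) $ w a $ j)"
    by (simp add: mult_ac)
  also have "\<dots> \<le> matrix_power A (b - a) $ w a $ w a * matrix_power A (a + (?n - b)) $ i $ j"
    by (intro mult_le_mult order_refl matrix_power_mult_entry_le)
  also have "a + (?n - b) = ?n - (b - a)" using ab by simp
  finally show ?thesis using ab by (intro bexI[of _ "b - a"] exI[of _ "w a"]) auto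
qed

section \<open>The Kleene star of a matrix with bounded cycles\<close>

lemma matrix_power_le_kleene_star:
  fixes B :: "'a::radicable_idempotent_semifield ^ 'n ^ 'n"
  shows "p < CARD('n) \<Longrightarrow> matrix_power B p $ i $ j \<le> kleene_star B $ i $ j"
  using le_sum[of "{..<CARD('n)}" p "\<lambda>p. matrix_power B p $ i $ j"]
  by (simp add: kleene_star_def)

lemma kleene_star_diag_ge_one:
  fixes B :: "'a::radicable_idempotent_semifield ^ 'n ^ 'n"
  shows "1 \<le> kleene_star B $ i $ i"
  using matrix_power_le_kleene_star[of 0 B i i] by (simp add: mat_def)

lemma mult_kleene_star_entry:
  fixes B :: "'a::radicable_idempotent_semifield ^ 'n ^ 'n"
  shows "(B ** kleene_star B) $ i $ j = (\<Sum>p<CARD('n). matrix_power B (Suc p) $ i $ j)"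
proof -
  have "(B ** kleene_star B) $ i $ j = (\<Sum>l\<in>UNIV. \<Sum>p<CARD('n). B $ i $ l * matrix_power B p $ l $ j)"
    by (simp add: kleene_star_def matrix_matrix_mult_def sum_distrib_left)
  also have "\<dots> = (\<Sum>p<CARD('n). \<Sum>l\<in>UNIV. B $ i $ l * matrix_power B p $ l $ j)"
    by (rule sum.swap)
  finally show ?thesis
    by (simp only: matrix_power_Suc_left) (simp add: matrix_matrix_mult_def)
qed

text \<open>
  Multiplication by \<open>B\<close> shifts the powers in \<open>B\<^sup>*\<close> by one, so that only \<open>B\<^sup>n\<close> is not already a term of \<open>B\<^sup>*\<close>.
  Removing a cycle of weight at most \<open>1\<close> from its walks does not decrease their weight.
\<close>

lemma mult_kleene_star_le:
  fixes B :: "'a::radicable_idempotent_semifield ^ 'n ^ 'n"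
  assumes cycles: "\<And>m l. m \<in> {1..CARD('n)} \<Longrightarrow> matrix_power B m $ l $ l \<le> 1"
  shows "(B ** kleene_star B) $ i $ j \<le> kleene_star B $ i $ j"
proof -
  have top: "matrix_power B CARD('n) $ i $ j \<le> kleene_star B $ i $ j"
  proof -
    obtain m l where m: "m \<in> {1..CARD('n)}" and
      decomp: "matrix_power B CARD('n) $ i $ j
        \<le> matrix_power B m $ l $ l * matrix_power B (CARD('n) - m) $ i $ j"
      using matrix_power_card_le_cycle[of B i j] by blast
    note decomp
    also have "\<dots> \<le> 1 * kleene_star B $ i $ j"
      using m by (intro mult_le_mult cycles matrix_power_le_kleene_star) auto
    finally show ?thesis by simp
  qed
  have "matrix_power B (Suc p) $ i $ j \<le> kleene_star B $ i $ j" if "p < CARD('n)" for p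
  proof (cases "Suc p = CARD('n)")
    case True
    then show ?thesis using top by metis
  next
    case False
    then show ?thesis using that by (intro matrix_power_le_kleene_star) simp
  qed
  then show ?thesis by (simp add: mult_kleene_star_entry sum_le_iff del: matrix_power.simps)
qed

text \<open>
  As all cycles are bounded by \<open>1\<close>, off the diagonal \<open>B\<^sup>*\<close> and \<open>BB\<^sup>*\<close> have the same entries, since \<open>B\<^sup>* = I + BB\<^sup>*\<close>.
  A cycle of weight \<open>1\<close> through \<open>i\<close> makes them agree at \<open>(i, i)\<close> as well, hence on the whole column.
\<close>

lemma mult_kleene_star_critical_column:
  fixes B :: "'a::radicable_idempotent_semifield ^ 'n ^ 'n"
  assumes cycles: "\<And>m l. m \<in> {1..CARD('n)} \<Longrightarrow> matrix_power B m $ l $ l \<le> 1"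
    and crit: "m \<in> {1..CARD('n)}" "matrix_power B m $ i $ i = 1"
  shows "B *v column i (kleene_star B) = column i (kleene_star B)"
proof -
  have Suc_le: "matrix_power B (Suc p) $ k $ l \<le> (B ** kleene_star B) $ k $ l"
    if "p < CARD('n)" for p k l
    using that unfolding mult_kleene_star_entry
    by (intro le_sum[of _ _ "\<lambda>p. matrix_power B (Suc p) $ k $ l"]) auto
  have "matrix_power B p $ k $ i \<le> (B ** kleene_star B) $ k $ i" if "p < CARD('n)" for p k
  proof (cases p)
    case 0
    have "1 \<le> (B ** kleene_star B) $ i $ i"
      using Suc_le[of "m - 1" i i] crit by (auto simp del: matrix_power.simps(2))
    with 0 show ?thesis by (auto simp: mat_def zero_least)
  next
    case (Suc q)
    then show ?thesis using that by (metis Suc_le Suc_lessD)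
  qed
  then have "kleene_star B $ k $ i \<le> (B ** kleene_star B) $ k $ i" for k
    by (simp add: kleene_star_def sum_le_iff)
  with mult_kleene_star_le[OF cycles]
  have "(B ** kleene_star B) $ k $ i = kleene_star B $ k $ i" for k
    by (intro order_antisym) auto
  then show ?thesis
    by (simp add: vec_eq_iff column_def matrix_vector_mult_def matrix_matrix_mult_def)
qed

section \<open>The inequality \<open>Bx \<le> x\<close>\<close>

lemma matrix_vector_le_iff:
  fixes B :: "'a::radicable_idempotent_semifield ^ 'n ^ 'm"
  shows "(B *v x) $ i \<le> c \<longleftrightarrow> (\<forall>j. B $ i $ j * x $ j \<le> c)"
  by (simp add: matrix_vector_mult_def sum_le_iff)

lemma matrix_vector_mono:
  fixes B :: "'a::radicable_idempotent_semifield ^ 'n ^ 'm"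
  assumes "\<And>i j. B $ i $ j \<le> C $ i $ j" "\<And>j. x $ j \<le> y $ j"
  shows "(B *v x) $ i \<le> (C *v y) $ i"
  unfolding matrix_vector_mult_def by (simp add: sum_mono mult_le_mult assms)

lemma matrix_power_vector_le:
  fixes B :: "'a::radicable_idempotent_semifield ^ 'n ^ 'n"
  assumes "\<And>i. (B *v x) $ i \<le> x $ i"
  shows "(matrix_power B p *v x) $ i \<le> x $ i"
proof (induction p arbitrary: i)
  case (Suc p)
  have "(matrix_power B (Suc p) *v x) $ i = (matrix_power B p *v (B *v x)) $ i"
    by (simp add: matrix_vector_mul_assoc)
  also have "\<dots> \<le> (matrix_power B p *v x) $ i"
    by (intro matrix_vector_mono assms order_refl)
  finally show ?case using Suc.IH order_trans by blast
qed simp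

lemma subinvariant_iff_kleene_star:
  fixes B :: "'a::radicable_idempotent_semifield ^ 'n ^ 'n"
  assumes absorb: "\<And>i j. (B ** kleene_star B) $ i $ j \<le> kleene_star B $ i $ j"
  shows "(\<forall>i. (B *v x) $ i \<le> x $ i) \<longleftrightarrow> (\<exists>u. x = kleene_star B *v u)"
proof
  assume x: "\<forall>i. (B *v x) $ i \<le> x $ i"
  have "x $ i = (kleene_star B *v x) $ i" for i
  proof (rule order_antisym)
    have "1 * x $ i \<le> kleene_star B $ i $ i * x $ i"
      by (intro mult_le_mult kleene_star_diag_ge_one order_refl)
    also have "\<dots> \<le> (kleene_star B *v x) $ i"
      using matrix_vector_le_iff by blast
    finally show "x $ i \<le> (kleene_star B *v x) $ i" by simp
    have "matrix_power B p $ i $ j * x $ j \<le> x $ i" for p j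
      using matrix_power_vector_le[of B x p i] x by (simp add: matrix_vector_le_iff)
    then show "(kleene_star B *v x) $ i \<le> x $ i"
      by (simp add: matrix_vector_le_iff kleene_star_def sum_distrib_right sum_le_iff)
  qed
  then show "\<exists>u. x = kleene_star B *v u" by (auto simp: vec_eq_iff)
next
  assume "\<exists>u. x = kleene_star B *v u"
  then obtain u where u: "x = kleene_star B *v u" by blast
  show "\<forall>i. (B *v x) $ i \<le> x $ i"
    unfolding u matrix_vector_mul_assoc by (intro allI matrix_vector_mono absorb order_refl)
qed

lemma regular_kleene_star_one:
  fixes B :: "'a::radicable_idempotent_semifield ^ 'n ^ 'n"
  shows "regular (kleene_star B *v (\<chi> i. 1))"
proof -
  have "1 \<le> (kleene_star B *v (\<chi> i. 1)) $ i" for i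
  proof -
    have "kleene_star B $ i $ i \<le> (kleene_star B *v (\<chi> i. 1)) $ i"
      using le_sum[of UNIV i "\<lambda>j. kleene_star B $ i $ j"] by (simp add: matrix_vector_mult_def)
    then show ?thesis using kleene_star_diag_ge_one order_trans by blast
  qed
  then show ?thesis unfolding regular_def by (metis zero_less_one not_le)
qed

section \<open>The quadratic form and eigenvalues\<close>

lemma quad_form_le_iff:
  fixes A :: "'a::radicable_idempotent_semifield ^ 'n ^ 'n"
  assumes "regular x"
  shows "quad_form A x \<le> c \<longleftrightarrow> (\<forall>i. (A *v x) $ i \<le> c * x $ i)"
proof -
  have nz: "x $ i \<noteq> 0" for i using assms by (simp add: regular_def)
  have "quad_form A x \<le> c \<longleftrightarrow> (\<forall>j i. inverse (x $ i) * A $ i $ j * x $ j \<le> c)"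
    by (simp add: quad_form_def scalar_product_def conj_transpose_def vector_matrix_mult_def
        nz sum_distrib_right sum_le_iff)
  also have "\<dots> \<longleftrightarrow> (\<forall>j i. A $ i $ j * x $ j \<le> c * x $ i)"
    by (simp add: mult.assoc inverse_mult_le_iff nz mult.commute[of c])
  finally show ?thesis by (auto simp: matrix_vector_le_iff)
qed

lemma quad_form_le_iff_scaled:
  fixes A :: "'a::radicable_idempotent_semifield ^ 'n ^ 'n"
  assumes "regular x" "c \<noteq> 0"
  shows "quad_form A x \<le> c \<longleftrightarrow> (\<forall>i. (scale_matrix (inverse c) A *v x) $ i \<le> x $ i)"
  by (simp add: quad_form_le_iff assms matrix_vector_le_iff scale_matrix_def mult.assoc
      inverse_mult_le_iff)

text \<open>
  The multiple \<open>t x\<close> with \<open>t = max v\<^sub>i / x\<^sub>i\<close> lies above \<open>v\<close> and touches it at some \<open>i\<close>. There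
  \<open>c v\<^sub>i = (A v)\<^sub>i \<le> t (A x)\<^sub>i \<le> t q x\<^sub>i = q v\<^sub>i\<close>, where \<open>q\<close> is the quadratic form at \<open>x\<close>.
\<close>

lemma eigenvalue_le_quad_form:
  fixes A :: "'a::radicable_idempotent_semifield ^ 'n ^ 'n"
  assumes "is_eigenvalue A c" and x: "regular x"
  shows "c \<le> quad_form A x"
proof -
  have nz: "x $ i \<noteq> 0" for i using x by (simp add: regular_def)
  obtain v where v: "v \<noteq> 0" "A *v v = c *s v"
    using assms(1) by (auto simp: is_eigenvalue_def)
  define q where "q = quad_form A x"
  define t where "t = (\<Sum>i\<in>UNIV. inverse (x $ i) * v $ i)"
  have above: "v $ j \<le> t * x $ j" for j
    using le_sum[of UNIV j "\<lambda>i. inverse (x $ i) * v $ i"]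
    by (simp add: inverse_mult_le_iff nz mult.commute[of t] flip: t_def)
  obtain i where "t = inverse (x $ i) * v $ i"
    using sum_attained[of UNIV "\<lambda>i. inverse (x $ i) * v $ i"] by (auto simp: t_def)
  then have touch: "t * x $ i = v $ i"
    by (simp add: inverse_mult_cancel_left nz mult.commute[of _ "x $ i"])
  have "t \<noteq> 0"
  proof
    assume "t = 0"
    then have "v $ j = 0" for j using above[of j] zero_least[of "v $ j"] by simp
    then show False using v(1) by (simp add: vec_eq_iff)
  qed
  have "A $ i $ j * v $ j \<le> q * v $ i" for j
  proof -
    have "A $ i $ j * v $ j \<le> A $ i $ j * (t * x $ j)"
      by (intro mult_le_mult above order_refl)
    also have "\<dots> = t * (A $ i $ j * x $ j)" by (simp add: mult_ac)
    also have "\<dots> \<le> t * (q * x $ i)"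
    proof (rule mult_le_mult[OF order_refl])
      have "(A *v x) $ i \<le> q * x $ i"
        using quad_form_le_iff[OF x, of A q] by (simp add: q_def)
      then show "A $ i $ j * x $ j \<le> q * x $ i" by (simp add: matrix_vector_le_iff)
    qed
    also have "\<dots> = q * v $ i" by (simp add: mult_ac flip: touch)
    finally show ?thesis .
  qed
  then have "(A *v v) $ i \<le> q * v $ i" by (simp add: matrix_vector_le_iff)
  then have "v $ i * c \<le> v $ i * q" by (simp add: v(2) mult.commute)
  moreover have "v $ i \<noteq> 0" using \<open>t \<noteq> 0\<close> nz touch by (metis mult_nonzero)
  ultimately show ?thesis by (simp add: mult_le_cancel_nonzero q_def)
qed

text \<open>
  If \<open>Av = cv\<close>, then \<open>c\<^sup>kv = A\<^sup>kv = 0\<close>, which forces \<open>c = 0\<close> as there are no zero divisors.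
\<close>

lemma nilpotent_spectral_radius:
  fixes A :: "'a::radicable_idempotent_semifield ^ 'n ^ 'n"
  assumes nil: "matrix_power A k = 0"
  shows "spectral_radius A = 0"
proof -
  define p where "p = (LEAST p. matrix_power A p = 0)"
  have p0: "matrix_power A p = 0" unfolding p_def using nil by (rule LeastI)
  have "(mat 1 :: 'a ^ 'n ^ 'n) \<noteq> 0" by (auto simp: vec_eq_iff mat_def)
  then obtain q where q: "p = Suc q" using p0 by (cases p) auto
  \<comment> \<open>Every nonzero column of the last nonzero power of \<open>A\<close> is annihilated by \<open>A\<close>.\<close>
  have "matrix_power A q \<noteq> 0"
    using q not_less_Least[of q "\<lambda>p. matrix_power A p = 0"] by (simp add: p_def)
  then obtain i j where ij: "matrix_power A q $ i $ j \<noteq> 0" by (auto simp: vec_eq_iff)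
  have "A *v column j (matrix_power A q) = column j (A ** matrix_power A q)"
    by (simp add: vec_eq_iff column_def matrix_vector_mult_def matrix_matrix_mult_def)
  also have "\<dots> = 0"
    using p0 q matrix_power_Suc_left[of A q] by (simp add: vec_eq_iff column_def)
  finally have "is_eigenvalue A 0"
    unfolding is_eigenvalue_def using ij
    by (intro exI[of _ "column j (matrix_power A q)"]) (auto simp: vec_eq_iff column_def)
  moreover have "c \<le> 0" if eig: "is_eigenvalue A c" for c
  proof -
    obtain v where v: "v \<noteq> 0" "A *v v = c *s v"
      using eig by (auto simp: is_eigenvalue_def)
    have "matrix_power A r *v v = c ^ r *s v" for r
    proof (induction r)
      case (Suc r)
      have "matrix_power A (Suc r) *v v = matrix_power A r *v (c *s v)"
        by (simp add: v(2) flip: matrix_vector_mul_assoc)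
      also have "\<dots> = c *s (matrix_power A r *v v)"
        by (simp add: vec_eq_iff matrix_vector_mult_def sum_distrib_left mult_ac)
      finally show ?case by (simp add: Suc.IH vec_eq_iff mult_ac)
    qed simp
    from this[of k] have "c ^ k *s v = 0"
      by (simp add: nil vec_eq_iff matrix_vector_mult_def)
    then have "c = 0" using v(1) by (simp add: vec_eq_iff) (metis mult_nonzero power_nonzero)
    then show ?thesis by simp
  qed
  ultimately show ?thesis
    unfolding spectral_radius_def by (intro Greatest_equality) auto
qed

section \<open>The maximal cycle mean is the spectral radius\<close>

text \<open>
  The value \<open>\<mu>\<close> is the maximal cycle mean: the greatest \<open>m\<close>-th root of a diagonal entry of \<open>A\<^sup>m\<close>.
  Dividing by it turns the bound \<open>\<mu>\<^sup>m\<close> on cycles of length \<open>m\<close> into the bound \<open>1\<close>.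
\<close>

lemma cycle_normalization:
  fixes A :: "'a::radicable_idempotent_semifield ^ 'n ^ 'n"
  obtains
    (acyclic) "\<And>m l. m \<in> {1..CARD('n)} \<Longrightarrow> matrix_power A m $ l $ l = 0"
  | (cyclic) mu m i where "mu \<noteq> 0"
      "\<And>m l. m \<in> {1..CARD('n)} \<Longrightarrow> matrix_power (scale_matrix (inverse mu) A) m $ l $ l \<le> 1"
      "m \<in> {1..CARD('n)}" "matrix_power (scale_matrix (inverse mu) A) m $ i $ i = 1"
proof -
  have "\<exists>y. y ^ m = matrix_power A m $ l $ l" if "m \<in> {1..CARD('n)}" for m l
    using that radicable[of m] by auto
  then obtain r where r: "r m l ^ m = matrix_power A m $ l $ l" if "m \<in> {1..CARD('n)}" for m l
    by metis
  define I where "I = {1..CARD('n)} \<times> (UNIV :: 'n set)"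
  have I: "finite I" "I \<noteq> {}" by (auto simp: I_def)
  define mu where "mu = (\<Sum>(m, l)\<in>I. r m l)"
  obtain e where "e \<in> I" "mu = (case e of (m, l) \<Rightarrow> r m l)"
    using sum_attained[OF I, of "\<lambda>(m, l). r m l"] unfolding mu_def by blast
  then obtain m i where mi: "m \<in> {1..CARD('n)}" "mu = r m i"
    by (auto simp: I_def)
  have mu: "r k l \<le> mu" if "k \<in> {1..CARD('n)}" for k l
    using le_sum[of I "(k, l)" "\<lambda>(m, l). r m l"] I(1) that by (auto simp: mu_def I_def)
  show thesis
  proof (cases "mu = 0")
    case True
    show thesis
    proof (rule acyclic)
      fix k l assume k: "k \<in> {1..CARD('n)}"
      then have "r k l = 0"
        using mu[OF k, of l] zero_least[of "r k l"] True by simp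
      then show "matrix_power A k $ l $ l = 0" using r[OF k, of l] k by (simp add: power_0_left)
    qed
  next
    case False
    have cancel: "inverse mu ^ k * mu ^ k = 1" for k
      by (simp add: inverse_mult_cancel[OF False] flip: power_mult_distrib)
    show thesis
    proof (rule cyclic[OF False _ mi(1)])
      show "matrix_power (scale_matrix (inverse mu) A) m $ i $ i = 1"
        using cancel[of m] r[OF mi(1), of i] by (simp add: matrix_power_scale flip: mi(2))
      fix k l assume k: "k \<in> {1..CARD('n)}"
      have "r k l ^ k \<le> mu ^ k" by (intro power_mono mu k zero_least)
      then have "inverse mu ^ k * r k l ^ k \<le> inverse mu ^ k * mu ^ k"
        by (intro mult_le_mult order_refl)
      then show "matrix_power (scale_matrix (inverse mu) A) k $ l $ l \<le> 1"
        using cancel r[OF k, of l] by (simp add: matrix_power_scale)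
    qed
  qed
qed

text \<open>
  A \<open>GREATEST\<close> value is known only after a greatest element has been exhibited. This makes the acyclic case
  necessary as well: it contradicts the assumption because \<open>0\<close> is then the greatest eigenvalue.
\<close>

lemma spectral_radius_pos:
  fixes A :: "'a::radicable_idempotent_semifield ^ 'n ^ 'n"
  assumes pos: "spectral_radius A > 0"
  defines "B \<equiv> scale_matrix (inverse (spectral_radius A)) A"
  shows "is_eigenvalue A (spectral_radius A)"
    and "\<And>i j. (B ** kleene_star B) $ i $ j \<le> kleene_star B $ i $ j"
proof -
  have "is_eigenvalue A (spectral_radius A) \<and>
    (\<forall>i j. (B ** kleene_star B) $ i $ j \<le> kleene_star B $ i $ j)"
  proof (cases A rule: cycle_normalization)
    case acyclic
    have "matrix_power A CARD('n) $ i $ j \<le> 0" for i j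
      using matrix_power_card_le_cycle[of A i j] acyclic by auto
    then have "matrix_power A CARD('n) = 0"
      using zero_least by (metis order_antisym vec_eq_iff zero_index)
    then show ?thesis using nilpotent_spectral_radius pos by fastforce
  next
    case (cyclic mu m i)
    define C where "C = scale_matrix (inverse mu) A"
    have cycles: "matrix_power C m $ l $ l \<le> 1" if "m \<in> {1..CARD('n)}" for m l
      using cyclic(2) that by (simp add: C_def)
    have absorb: "(C ** kleene_star C) $ k $ l \<le> kleene_star C $ k $ l" for k l
      by (rule mult_kleene_star_le[OF cycles])
    let ?v = "column i (kleene_star C)"
    have "C *v ?v = ?v"
      using cycles cyclic(3,4) by (intro mult_kleene_star_critical_column) (auto simp: C_def)
    moreover have "A *v ?v = mu *s (C *v ?v)"
      by (simp add: vec_eq_iff matrix_vector_mult_def C_def scale_matrix_def sum_distrib_left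
          mult.assoc inverse_mult_cancel_left cyclic(1))
    moreover have "?v $ i \<noteq> 0"
      using kleene_star_diag_ge_one[of C i] by (auto simp: column_def simp flip: not_less)
    ultimately have eig: "is_eigenvalue A mu"
      unfolding is_eigenvalue_def by (intro exI[of _ ?v]) auto
    let ?x = "kleene_star C *v (\<chi> i. 1)"
    have "quad_form A ?x \<le> mu"
      unfolding quad_form_le_iff_scaled[OF regular_kleene_star_one cyclic(1)]
      using subinvariant_iff_kleene_star[OF absorb, of ?x] by (auto simp: C_def)
    then have "c \<le> mu" if "is_eigenvalue A c" for c
      using eigenvalue_le_quad_form[OF that regular_kleene_star_one] order_trans by blast
    with eig have "spectral_radius A = mu"
      unfolding spectral_radius_def by (intro Greatest_equality)
    then show ?thesis using eig absorb by (simp add: B_def C_def)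
  qed
  then show "is_eigenvalue A (spectral_radius A)"
    and "\<And>i j. (B ** kleene_star B) $ i $ j \<le> kleene_star B $ i $ j" by auto
qed

section \<open>Minimization of the quadratic form\<close>

theorem lemma4:
  fixes A :: "'a::radicable_idempotent_semifield ^ 'n ^ 'n" and lam :: 'a
  assumes "spectral_radius A = lam" and "lam > 0"
  shows "(\<exists>x. regular x \<and> quad_form A x = lam) \<and>
         (\<forall>x. regular x \<longrightarrow> lam \<le> quad_form A x) \<and>
         (\<forall>x. regular x \<longrightarrow>
            (is_arg_min (quad_form A) regular x \<longleftrightarrow>
             (\<exists>u. x = kleene_star (scale_matrix (inverse lam) A) *v u)))"
proof -
  let ?S = "kleene_star (scale_matrix (inverse lam) A)"
  have eig: "is_eigenvalue A lam"
    and absorb: "\<And>i j. (scale_matrix (inverse lam) A ** ?S) $ i $ j \<le> ?S $ i $ j"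
    using spectral_radius_pos[of A] assms by auto
  have lower: "lam \<le> quad_form A x" if "regular x" for x
    using eigenvalue_le_quad_form[OF eig that] .
  have sublevel: "quad_form A x \<le> lam \<longleftrightarrow> (\<exists>u. x = ?S *v u)" if "regular x" for x
    using quad_form_le_iff_scaled[OF that] subinvariant_iff_kleene_star[OF absorb] assms(2)
    by (simp add: pos_iff_nonzero)
  let ?x = "?S *v (\<chi> i. 1)"
  have x: "regular ?x" "quad_form A ?x = lam"
    using regular_kleene_star_one sublevel lower by (blast intro: order_antisym)+
  have "is_arg_min (quad_form A) regular y \<longleftrightarrow> quad_form A y \<le> lam" if "regular y" for y
    using that x lower unfolding is_arg_min_def by (metis not_le order_trans)
  with x lower sublevel show ?thesis by blast
qed

end
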